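(* Let $\xi_T,\tilde\xi_T\in L^2(\mathcal F_T)$ and let the mappings $g,h:\Omega\times[0,T]\times\mathbb R\to\mathbb R$ be such that the generalized BSDEs $$Y_t=\xi_T-\int_{]t,T]}Z_s\,dM_s+\int_{]t,T]}g(s,Y_s)\,dA_s,\qquad t\in[0,T],$$ and $$\tilde Y_t=\tilde\xi_T-\int_{]t,T]}\tilde Z_s\,dM_s+\int_{]t,T]}h(s,\tilde Y_s)\,dA_s,\qquad t\in[0,T],$$ have solutions $(Y,Z)$ and $(\tilde Y,\tilde Z)$, respectively. Assume that $\xi_T\ge\tilde\xi_T$ and that: (i) $g(\omega,t,y)\ge h(\omega,t,y)$ for every $(\omega,t,y)\in\Omega\times[0,T]\times\mathbb R$; (ii) $g(\omega,t,\cdot)$ is a nonincreasing function for every $(\omega,t)\in\Omega\times[0,T]$. Then $Y\ge\tilde Y$, that is, $\mathbb P(Y_t\ge\tilde Y_t\ \ \forall\,t\in[0,T])=1$.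
   Context: Standing assumptions: $T>0$ is fixed; $(\Omega,\mathcal F,\mathbb P)$ is a probability space with a filtration $\mathbb F=(\mathcal F_t)_{t\in[0,T]}$ satisfying the usual conditions; $M$ is an $\mathbb R^d$-valued square-integrable $\mathbb F$-martingale having the predictable representation property for $\mathbb F$ (local martingales of $\mathbb F$ are, up to their initial value, stochastic integrals $\int Z\,dM$ of $\mathbb F$-predictable processes); $A$ is an $\mathbb F$-adapted, nondecreasing, continuous process with $A_0=0$ and $\mathbb E[A_T^2]<\infty$. Generators are $\mathcal P(\mathbb F)\otimes\mathcal B(\mathbb R)$-measurable, where $\mathcal P(\mathbb F)$ is the predictable $\sigma$-field on $\Omega\times[0,T]$. Definition. A solution to the generalized BSDE with data $(M,A,g,\xi_T)$ is a pair $(Y,Z)$ where $Y$ is $\mathbb F$-adapted and càdlàg, $Z$ is $\mathbb F$-predictable, $Y_t=\xi_T-\int_{]t,T]}Z_s\,dM_s+\int_{]t,T]}g(s,Y_s)\,dA_s$ for every $t\in[0,T]$, the Itô integral $\int_{]0,t]}Z_s\,dM_s$ is a martingale, and $\int_0^t g(s,Y_s)\,dA_s$ is an $\mathbb F$-adapted, continuous process of finite variation. *)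

theory Defs
  imports "HOL-Probability.Probability"
begin

text \<open>
  Processes are curried, time first: \<open>X t \<omega>\<close>. The time set is \<open>[0, T]\<close>; only the values \<open>X t\<close> with
  \<open>t \<in> {0..T}\<close> are ever used. The library locale \<open>filtration\<close> indexes the filtration by all reals;
  a filtration on \<open>[0, T]\<close> is understood to be extended by \<open>F 0\<close> to the left and by \<open>F T\<close> to the right.
  Properties of paths are required for almost every \<open>\<omega>\<close>.
\<close>

locale stochastic_basis =
  prob_space P + complete_measure P + filtration "space P" F
  for P :: "'a measure" and F :: "real \<Rightarrow> 'a measure" +
  fixes T :: real
  assumes T_pos: "0 < T"
    and subalgebra_F: "\<And>t. t \<in> {0..T} \<Longrightarrow> subalgebra P (F t)"
    and null_sets_F: "null_sets P \<subseteq> sets (F 0)"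
    and right_continuous_F: "\<And>t. t \<in> {0..<T} \<Longrightarrow> sets (F t) = (\<Inter>s\<in>{t<..T}. sets (F s))"

definition adapted :: "(real \<Rightarrow> 'a measure) \<Rightarrow> real \<Rightarrow> (real \<Rightarrow> 'a \<Rightarrow> 'b::topological_space) \<Rightarrow> bool" where
  "adapted F T X \<longleftrightarrow> (\<forall>t\<in>{0..T}. X t \<in> borel_measurable (F t))"

definition cadlag_on :: "real \<Rightarrow> (real \<Rightarrow> 'b::topological_space) \<Rightarrow> bool" where
  "cadlag_on T f \<longleftrightarrow> (\<forall>t\<in>{0..<T}. (f \<longlongrightarrow> f t) (at_right t)) \<and>
     (\<forall>t\<in>{0<..T}. \<exists>l. (f \<longlongrightarrow> l) (at_left t))"

definition cadlag_process :: "'a measure \<Rightarrow> real \<Rightarrow> (real \<Rightarrow> 'a \<Rightarrow> 'b::topological_space) \<Rightarrow> bool" where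
  "cadlag_process P T X \<longleftrightarrow> (AE \<omega> in P. cadlag_on T (\<lambda>t. X t \<omega>))"

definition finite_variation_on :: "real \<Rightarrow> (real \<Rightarrow> real) \<Rightarrow> bool" where
  "finite_variation_on T f \<longleftrightarrow>
     (\<exists>B. \<forall>ts :: nat \<Rightarrow> real. \<forall>n. mono ts \<and> range ts \<subseteq> {0..T} \<longrightarrow>
        (\<Sum>k<n. \<bar>f (ts (Suc k)) - f (ts k)\<bar>) \<le> B)"

definition predictable_algebra :: "(real \<Rightarrow> 'a measure) \<Rightarrow> real \<Rightarrow> ('a \<times> real) measure" where
  "predictable_algebra F T = sigma (space (F 0) \<times> {0..T})
     ({B \<times> {0} | B. B \<in> sets (F 0)} \<union>
      {B \<times> {s<..t} | B s t. 0 \<le> s \<and> s \<le> t \<and> t \<le> T \<and> B \<in> sets (F s)})"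

definition predictable :: "(real \<Rightarrow> 'a measure) \<Rightarrow> real \<Rightarrow> (real \<Rightarrow> 'a \<Rightarrow> 'b::topological_space) \<Rightarrow> bool" where
  "predictable F T Z \<longleftrightarrow> (\<lambda>(\<omega>, t). Z t \<omega>) \<in> borel_measurable (predictable_algebra F T)"


subsection \<open>Martingales\<close>

text \<open>
  As usual under the usual conditions, martingales are taken in their cadlag version.
  Conditional expectations of vectors are formed coordinatewise.
\<close>

definition martingale ::
    "'a measure \<Rightarrow> (real \<Rightarrow> 'a measure) \<Rightarrow> real \<Rightarrow> (real \<Rightarrow> 'a \<Rightarrow> 'b::euclidean_space) \<Rightarrow> bool" where
  "martingale P F T X \<longleftrightarrow> adapted F T X \<and> cadlag_process P T X \<and>
     (\<forall>t\<in>{0..T}. integrable P (X t)) \<and>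
     (\<forall>b\<in>Basis. \<forall>s\<in>{0..T}. \<forall>t\<in>{s..T}.
        AE \<omega> in P. real_cond_exp P (F s) (\<lambda>\<omega>. X t \<omega> \<bullet> b) \<omega> = X s \<omega> \<bullet> b)"

definition square_integrable_martingale ::
    "'a measure \<Rightarrow> (real \<Rightarrow> 'a measure) \<Rightarrow> real \<Rightarrow> (real \<Rightarrow> 'a \<Rightarrow> 'b::euclidean_space) \<Rightarrow> bool" where
  "square_integrable_martingale P F T X \<longleftrightarrow> martingale P F T X \<and>
     (\<forall>t\<in>{0..T}. integrable P (\<lambda>\<omega>. (norm (X t \<omega>))\<^sup>2))"

text \<open>
  On the compact time set \<open>[0, T]\<close> a localizing sequence has to reach \<open>T\<close> after finitely many steps.
\<close>

definition local_martingale ::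
    "'a measure \<Rightarrow> (real \<Rightarrow> 'a measure) \<Rightarrow> real \<Rightarrow> (real \<Rightarrow> 'a \<Rightarrow> 'b::euclidean_space) \<Rightarrow> bool" where
  "local_martingale P F T X \<longleftrightarrow> adapted F T X \<and> cadlag_process P T X \<and>
     (\<exists>\<tau> :: nat \<Rightarrow> 'a \<Rightarrow> real.
        (\<forall>n. stopping_time F (\<tau> n)) \<and>
        (\<forall>\<omega>\<in>space P. incseq (\<lambda>n. \<tau> n \<omega>) \<and> (\<forall>n. \<tau> n \<omega> \<in> {0..T})) \<and>
        (AE \<omega> in P. \<exists>n. \<tau> n \<omega> = T) \<and>
        (\<forall>n. martingale P F T (\<lambda>t \<omega>. X (min t (\<tau> n \<omega>)) \<omega> - X 0 \<omega>)))"


subsection \<open>The Ito integral with respect to a square-integrable martingale\<close>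

text \<open>
  A list of triples \<open>(s, t, \<eta>)\<close> represents the elementary integrand \<open>\<Sum> \<eta> 1\<^bsub>]s,t]\<^esub>\<close>.
\<close>

definition elementary ::
    "(real \<Rightarrow> 'a measure) \<Rightarrow> real \<Rightarrow> (real \<times> real \<times> ('a \<Rightarrow> 'b::real_normed_vector)) list \<Rightarrow> bool" where
  "elementary F T H \<longleftrightarrow> (\<forall>(s, t, \<eta>)\<in>set H. 0 \<le> s \<and> s \<le> t \<and> t \<le> T \<and>
     \<eta> \<in> borel_measurable (F s) \<and> bounded (\<eta> ` space (F s)))"

definition elem_process ::
    "(real \<times> real \<times> ('a \<Rightarrow> 'b::real_normed_vector)) list \<Rightarrow> real \<Rightarrow> 'a \<Rightarrow> 'b" where
  "elem_process H u \<omega> = (\<Sum>(s, t, \<eta>)\<leftarrow>H. indicator {s<..t} u *\<^sub>R \<eta> \<omega>)"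

definition elem_integral ::
    "(real \<times> real \<times> ('a \<Rightarrow> 'b::real_inner)) list \<Rightarrow> (real \<Rightarrow> 'a \<Rightarrow> 'b) \<Rightarrow> real \<Rightarrow> 'a \<Rightarrow> real" where
  "elem_integral H X u \<omega> = (\<Sum>(s, t, \<eta>)\<leftarrow>H. \<eta> \<omega> \<bullet> (X (min u t) \<omega> - X (min u s) \<omega>))"

text \<open>
  The Doleans measure of \<open>M\<close>, i.e. \<open>E \<integral> 1\<^bsub>C\<^esub> d(\<Sum>i. \<langle>M\<^sup>i\<rangle>)\<close> for predictable \<open>C\<close>. The values prescribed
  below determine it uniquely.
\<close>

definition doleans_measure ::
    "'a measure \<Rightarrow> (real \<Rightarrow> 'a measure) \<Rightarrow> real \<Rightarrow> (real \<Rightarrow> 'a \<Rightarrow> 'b::euclidean_space) \<Rightarrow>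
     ('a \<times> real) measure \<Rightarrow> bool" where
  "doleans_measure P F T M \<mu> \<longleftrightarrow>
     space \<mu> = space (predictable_algebra F T) \<and> sets \<mu> = sets (predictable_algebra F T) \<and>
     (\<forall>B\<in>sets (F 0). emeasure \<mu> (B \<times> {0}) = 0) \<and>
     (\<forall>s\<in>{0..T}. \<forall>t\<in>{s..T}. \<forall>B\<in>sets (F s).
        emeasure \<mu> (B \<times> {s<..t}) = (\<integral>\<^sup>+\<omega>\<in>B. ennreal ((norm (M t \<omega> - M s \<omega>))\<^sup>2) \<partial>P))"

text \<open>
  Integrands that are square integrable with respect to the Doleans measure (in particular bounded
  ones): approximation by elementary integrands and the Ito isometry.
\<close>

definition ito_integral_L2 ::
    "'a measure \<Rightarrow> (real \<Rightarrow> 'a measure) \<Rightarrow> real \<Rightarrow> (real \<Rightarrow> 'a \<Rightarrow> 'b::euclidean_space) \<Rightarrow>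
     (real \<Rightarrow> 'a \<Rightarrow> 'b) \<Rightarrow> (real \<Rightarrow> 'a \<Rightarrow> real) \<Rightarrow> bool" where
  "ito_integral_L2 P F T M Z N \<longleftrightarrow>
     predictable F T Z \<and> adapted F T N \<and> cadlag_process P T N \<and>
     (\<exists>\<mu> H. doleans_measure P F T M \<mu> \<and> (\<forall>n. elementary F T (H n)) \<and>
        ((\<lambda>n. \<integral>\<^sup>+(\<omega>, t). ennreal ((norm (elem_process (H n) t \<omega> - Z t \<omega>))\<^sup>2) \<partial>\<mu>)
           \<longlonglongrightarrow> 0) \<and>
        (\<forall>t\<in>{0..T}. (\<lambda>n. \<integral>\<^sup>+\<omega>. ennreal ((elem_integral (H n) M t \<omega> - N t \<omega>)\<^sup>2) \<partial>P)
           \<longlonglongrightarrow> 0))"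

text \<open>Convergence in Emery's semimartingale topology on \<open>[0, T]\<close>, for processes null at time \<open>0\<close>.\<close>

definition emery_tendsto ::
    "'a measure \<Rightarrow> (real \<Rightarrow> 'a measure) \<Rightarrow> real \<Rightarrow> (nat \<Rightarrow> real \<Rightarrow> 'a \<Rightarrow> real) \<Rightarrow>
     (real \<Rightarrow> 'a \<Rightarrow> real) \<Rightarrow> bool" where
  "emery_tendsto P F T X N \<longleftrightarrow>
     (\<lambda>n. SUP H \<in> {H. elementary F T H \<and> (\<forall>\<omega>\<in>space P. \<forall>u\<in>{0..T}. \<bar>elem_process H u \<omega>\<bar> \<le> 1)}.
        \<integral>\<^sup>+\<omega>. (SUP u\<in>{0..T}. ennreal (min 1 \<bar>elem_integral H (\<lambda>t \<omega>. X n t \<omega> - N t \<omega>) u \<omega>\<bar>)) \<partial>P)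
       \<longlonglongrightarrow> 0"

text \<open>
  \<open>ito_integral P F T M Z N\<close>: the integrand \<open>Z\<close> is \<open>M\<close>-integrable and \<open>N t = \<integral>\<^bsub>]0,t]\<^esub> Z dM\<close>. This is
  the general vector stochastic integral, obtained as the limit of the integrals of the truncations
  \<open>Z 1\<^bsub>{|Z| \<le> n}\<^esub>\<close>. Restricting to (locally) square-integrable \<open>Z\<close> would be too narrow: if \<open>M\<close> has
  jumps, local martingales need not be locally square integrable.
\<close>

definition ito_integral ::
    "'a measure \<Rightarrow> (real \<Rightarrow> 'a measure) \<Rightarrow> real \<Rightarrow> (real \<Rightarrow> 'a \<Rightarrow> 'b::euclidean_space) \<Rightarrow>
     (real \<Rightarrow> 'a \<Rightarrow> 'b) \<Rightarrow> (real \<Rightarrow> 'a \<Rightarrow> real) \<Rightarrow> bool" where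
  "ito_integral P F T M Z N \<longleftrightarrow>
     predictable F T Z \<and> adapted F T N \<and> cadlag_process P T N \<and> (AE \<omega> in P. N 0 \<omega> = 0) \<and>
     (\<exists>X. (\<forall>n. ito_integral_L2 P F T M (\<lambda>t \<omega>. if norm (Z t \<omega>) \<le> real n then Z t \<omega> else 0) (X n)) \<and>
        emery_tendsto P F T X N)"

definition predictable_representation ::
    "'a measure \<Rightarrow> (real \<Rightarrow> 'a measure) \<Rightarrow> real \<Rightarrow> (real \<Rightarrow> 'a \<Rightarrow> 'b::euclidean_space) \<Rightarrow> bool" where
  "predictable_representation P F T M \<longleftrightarrow>
     (\<forall>N :: real \<Rightarrow> 'a \<Rightarrow> real. local_martingale P F T N \<longrightarrow>
        (\<exists>Z. ito_integral P F T M Z (\<lambda>t \<omega>. N t \<omega> - N 0 \<omega>)))"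


subsection \<open>Generalized BSDEs\<close>

definition bsde_clock ::
    "'a measure \<Rightarrow> (real \<Rightarrow> 'a measure) \<Rightarrow> real \<Rightarrow> (real \<Rightarrow> 'a \<Rightarrow> real) \<Rightarrow> bool" where
  "bsde_clock P F T A \<longleftrightarrow> adapted F T A \<and>
     (AE \<omega> in P. A 0 \<omega> = 0 \<and> mono_on {0..T} (\<lambda>t. A t \<omega>) \<and> continuous_on {0..T} (\<lambda>t. A t \<omega>)) \<and>
     integrable P (\<lambda>\<omega>. (A T \<omega>)\<^sup>2)"

text \<open>
  The Lebesgue-Stieltjes measure of the path \<open>A(\<omega>)\<close>, extended as a constant outside \<open>[0, T]\<close>.
\<close>

definition stieltjes :: "real \<Rightarrow> (real \<Rightarrow> 'a \<Rightarrow> real) \<Rightarrow> 'a \<Rightarrow> real measure" where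
  "stieltjes T A \<omega> = interval_measure (\<lambda>t. A (max 0 (min T t)) \<omega>)"

definition generator :: "(real \<Rightarrow> 'a measure) \<Rightarrow> real \<Rightarrow> ('a \<Rightarrow> real \<Rightarrow> real \<Rightarrow> real) \<Rightarrow> bool" where
  "generator F T g \<longleftrightarrow>
     (\<lambda>((\<omega>, t), y). g \<omega> t y) \<in> borel_measurable (predictable_algebra F T \<Otimes>\<^sub>M borel)"

text \<open>
  The integrability condition says that the pathwise Lebesgue-Stieltjes integral exists; the
  library integral of a non-integrable function is \<open>0\<close>.
\<close>

definition gbsde_solution ::
    "'a measure \<Rightarrow> (real \<Rightarrow> 'a measure) \<Rightarrow> real \<Rightarrow> (real \<Rightarrow> 'a \<Rightarrow> 'b::euclidean_space) \<Rightarrow>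
     (real \<Rightarrow> 'a \<Rightarrow> real) \<Rightarrow> ('a \<Rightarrow> real \<Rightarrow> real \<Rightarrow> real) \<Rightarrow> ('a \<Rightarrow> real) \<Rightarrow>
     (real \<Rightarrow> 'a \<Rightarrow> real) \<Rightarrow> (real \<Rightarrow> 'a \<Rightarrow> 'b) \<Rightarrow> bool" where
  "gbsde_solution P F T M A g \<xi> Y Z \<longleftrightarrow>
     adapted F T Y \<and> cadlag_process P T Y \<and> predictable F T Z \<and>
     (AE \<omega> in P. set_integrable (stieltjes T A \<omega>) {0<..T} (\<lambda>s. g \<omega> s (Y s \<omega>))) \<and>
     (let G = (\<lambda>t \<omega>. LINT s:{0<..t}|stieltjes T A \<omega>. g \<omega> s (Y s \<omega>))
      in adapted F T G \<and>
         (AE \<omega> in P. continuous_on {0..T} (\<lambda>t. G t \<omega>) \<and> finite_variation_on T (\<lambda>t. G t \<omega>))) \<and>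
     (\<exists>N. ito_integral P F T M Z N \<and> martingale P F T N \<and>
        (\<forall>t\<in>{0..T}. AE \<omega> in P.
           Y t \<omega> = \<xi> \<omega> - (N T \<omega> - N t \<omega>) + (LINT s:{t<..T}|stieltjes T A \<omega>. g \<omega> s (Y s \<omega>))))"

end

theory Submission
  imports Defs
begin

text \<open>
  Write \<open>D = Y' - Y\<close>, \<open>K = N' - N\<close> for the difference of the two stochastic integrals, and
  \<open>V t = \<integral>\<^bsub>]0,t]\<^esub> (g(s, Y\<^sub>s) - h(s, Y'\<^sub>s)) dA\<^sub>s\<close>. Subtracting the two equations shows that
  \<open>D - K - V\<close> does not depend on time; \<open>K\<close> is a martingale, \<open>V\<close> has continuous paths, and
  \<open>D\<^sub>T = \<xi>' - \<xi> \<le> 0\<close>. Wherever \<open>D \<ge> 0\<close>, the hypotheses on the generators give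
  \<open>h(s, Y') \<le> g(s, Y') \<le> g(s, Y)\<close>, so \<open>V\<close> increases as long as \<open>D\<close> stays nonnegative.

  This forces \<open>D \<le> 0\<close>. On the event \<open>B = {D\<^sub>t > 0}\<close> let \<open>\<tau>\<close> be the infimum of the times after \<open>t\<close> at
  which \<open>D < 0\<close>, or \<open>T\<close> if there are none. Up to \<open>\<tau>\<close> the drift \<open>V\<close> has increased, whereas
  \<open>D\<^sub>\<tau> \<le> 0\<close>. So on \<open>B\<close>
  \<open>0 < D\<^sub>t \<le> D\<^sub>\<tau> + (K\<^sub>t - K\<^sub>\<tau>) - (V\<^sub>\<tau> - V\<^sub>t) \<le> K\<^sub>t - K\<^sub>\<tau>\<close>, and the right-hand side has integral \<open>0\<close> over
  \<open>B\<close> by optional sampling. Hence \<open>B\<close> is a null set; right-continuity then yields one null set for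
  all \<open>t\<close> at once. The integrable bound \<open>K\<^sub>t - K\<^sub>\<tau>\<close> makes the argument work although \<open>D\<^sub>t\<close> and
  \<open>V\<^sub>\<tau>\<close> may fail to be integrable.

  Optional sampling is applied only to stopping times with finitely many values, by letting \<open>\<sigma>\<^sub>n\<close> be
  the first time in a finite set \<open>S\<^sub>n\<close> at which \<open>D < 0\<close>. If the sets \<open>S\<^sub>n\<close> increase to a dense set,
  then \<open>\<sigma>\<^sub>n\<close> decreases to \<open>\<tau>\<close>, because the strict inequality \<open>D < 0\<close> persists to the right of any time
  (lemma \<open>first_negative_limit\<close>). Uniform integrability of the values of \<open>K\<close> at \<open>\<sigma>\<^sub>n\<close> is replaced
  by a one-sided truncation: \<open>min K c\<close> is a supermartingale bounded above, which is all that a limit in the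
  direction of the reverse Fatou lemma requires, and \<open>c\<close> tends to infinity at the end
  (lemma \<open>nonpositive_at_time\<close>).
\<close>

section \<open>Martingales on events\<close>

context stochastic_basis
begin

lemma space_F_eq [simp]: "space (F t) = space P"
  by (rule space_F)

lemma sets_F_subset: "t \<in> {0..T} \<Longrightarrow> B \<in> sets (F t) \<Longrightarrow> B \<in> sets P"
  using subalgebra_F by (auto simp: subalgebra_def)

lemma adapted_measurable:
  assumes "adapted F T X" and "t \<in> {0..T}"
  shows "X t \<in> borel_measurable P"
  using assms by (intro measurable_from_subalg[OF subalgebra_F]) (auto simp: adapted_def)

lemma adapted_diff:
  fixes X X' :: "real \<Rightarrow> 'a \<Rightarrow> real"
  assumes "adapted F T X" and "adapted F T X'"
  shows "adapted F T (\<lambda>t \<omega>. X t \<omega> - X' t \<omega>)"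
  unfolding adapted_def
proof
  fix t assume "t \<in> {0..T}"
  then have "X t \<in> borel_measurable (F t)" "X' t \<in> borel_measurable (F t)"
    using assms by (simp_all only: adapted_def)
  then show "(\<lambda>\<omega>. X t \<omega> - X' t \<omega>) \<in> borel_measurable (F t)"
    by (rule borel_measurable_diff)
qed

lemma martingaleD:
  fixes X :: "real \<Rightarrow> 'a \<Rightarrow> real"
  assumes "martingale P F T X"
  shows "adapted F T X"
    and "cadlag_process P T X"
    and "t \<in> {0..T} \<Longrightarrow> integrable P (X t)"
    and "s \<in> {0..T} \<Longrightarrow> t \<in> {s..T} \<Longrightarrow> AE \<omega> in P. real_cond_exp P (F s) (X t) \<omega> = X s \<omega>"
  using assms by (simp_all add: martingale_def)

lemma cadlag_on_diff:
  fixes f f' :: "real \<Rightarrow> real"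
  assumes "cadlag_on T f" and "cadlag_on T f'"
  shows "cadlag_on T (\<lambda>t. f t - f' t)"
  unfolding cadlag_on_def
proof (intro conjI ballI)
  show "((\<lambda>t. f t - f' t) \<longlongrightarrow> f t - f' t) (at_right t)" if "t \<in> {0..<T}" for t
    using assms that by (intro tendsto_diff) (simp_all add: cadlag_on_def)
  show "\<exists>l. ((\<lambda>t. f t - f' t) \<longlongrightarrow> l) (at_left t)" if "t \<in> {0<..T}" for t
  proof -
    obtain l l' where "(f \<longlongrightarrow> l) (at_left t)" "(f' \<longlongrightarrow> l') (at_left t)"
      using assms \<open>t \<in> {0<..T}\<close> unfolding cadlag_on_def by metis
    from tendsto_diff[OF this] show ?thesis ..
  qed
qed

lemma martingale_diff:
  fixes X X' :: "real \<Rightarrow> 'a \<Rightarrow> real"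
  assumes X: "martingale P F T X" and X': "martingale P F T X'"
  shows "martingale P F T (\<lambda>t \<omega>. X t \<omega> - X' t \<omega>)"
proof -
  have "adapted F T (\<lambda>t \<omega>. X t \<omega> - X' t \<omega>)"
    using martingaleD(1)[OF X] martingaleD(1)[OF X'] by (rule adapted_diff)
  moreover have "cadlag_process P T (\<lambda>t \<omega>. X t \<omega> - X' t \<omega>)"
    using martingaleD(2)[OF X] martingaleD(2)[OF X'] unfolding cadlag_process_def
    by eventually_elim (rule cadlag_on_diff)
  moreover have "AE \<omega> in P. real_cond_exp P (F s) (\<lambda>\<omega>. X t \<omega> - X' t \<omega>) \<omega> = X s \<omega> - X' s \<omega>"
    if s: "s \<in> {0..T}" and t: "t \<in> {s..T}" for s t
  proof -
    interpret sub: finite_measure_subalgebra P "F s"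
      using subalgebra_F[OF s] by unfold_locales
    have "t \<in> {0..T}" using s t by simp
    then have "AE \<omega> in P. real_cond_exp P (F s) (\<lambda>\<omega>. X t \<omega> - X' t \<omega>) \<omega>
        = real_cond_exp P (F s) (X t) \<omega> - real_cond_exp P (F s) (X' t) \<omega>"
      using X X' by (intro sub.real_cond_exp_diff martingaleD(3))
    with martingaleD(4)[OF X s t] martingaleD(4)[OF X' s t] show ?thesis
      by eventually_elim simp
  qed
  ultimately show ?thesis
    using martingaleD(3)[OF X] martingaleD(3)[OF X'] by (simp add: martingale_def)
qed

lemma martingale_integrable_indicator:
  fixes X :: "real \<Rightarrow> 'a \<Rightarrow> real"
  assumes "martingale P F T X" and "s \<in> {0..T}" and "B \<in> sets P"
  shows "integrable P (\<lambda>\<omega>. indicator B \<omega> * X s \<omega>)"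
    and "integrable P (\<lambda>\<omega>. indicator B \<omega> * min (X s \<omega>) c)"
proof -
  have X: "integrable P (X s)"
    using assms(1,2) by (rule martingaleD(3))
  then have "integrable P (\<lambda>\<omega>. min (X s \<omega>) c)"
    by (intro Bochner_Integration.integrable_min integrable_const)
  from integrable_mult_indicator[OF assms(3) X] integrable_mult_indicator[OF assms(3) this]
  show "integrable P (\<lambda>\<omega>. indicator B \<omega> * X s \<omega>)"
    "integrable P (\<lambda>\<omega>. indicator B \<omega> * min (X s \<omega>) c)"
    by (simp_all only: real_scaleR_def)
qed

lemma martingale_integral_event:
  fixes X :: "real \<Rightarrow> 'a \<Rightarrow> real"
  assumes "martingale P F T X" and "s \<in> {0..T}" and "B \<in> sets (F s)"
  shows "(\<integral>\<omega>. indicator B \<omega> * X s \<omega> \<partial>P) = (\<integral>\<omega>. indicator B \<omega> * X T \<omega> \<partial>P)"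
proof -
  note X = martingaleD[OF assms(1)]
  interpret sub: finite_measure_subalgebra P "F s"
    using subalgebra_F[OF assms(2)] by unfold_locales
  have T: "T \<in> {0..T}" "T \<in> {s..T}"
    using T_pos assms(2) by auto
  have [measurable]: "X s \<in> borel_measurable P" "B \<in> sets P"
    using adapted_measurable[OF X(1) assms(2)] sets_F_subset[OF assms(2,3)] by auto
  have "(\<integral>\<omega>. indicator B \<omega> * X T \<omega> \<partial>P) = (\<integral>\<omega>\<in>B. X T \<omega> \<partial>P)"
    by (simp add: set_lebesgue_integral_def)
  also have "\<dots> = (\<integral>\<omega>\<in>B. real_cond_exp P (F s) (X T) \<omega> \<partial>P)"
    using X(3)[OF T(1)] assms(3) by (intro sub.real_cond_exp_intA)
  also have "\<dots> = (\<integral>\<omega>. indicator B \<omega> * X s \<omega> \<partial>P)"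
    unfolding set_lebesgue_integral_def
  proof (rule integral_cong_AE)
    have "AE \<omega> in P. real_cond_exp P (F s) (X T) \<omega> = X s \<omega>"
      using X(4)[OF assms(2) T(2)] .
    then show "AE \<omega> in P. indicator B \<omega> *\<^sub>R real_cond_exp P (F s) (X T) \<omega> = indicator B \<omega> * X s \<omega>"
      by eventually_elim simp
  qed auto
  finally show ?thesis ..
qed

text \<open>
  Concave functions of a martingale are supermartingales. For the truncation \<open>min _ c\<close> it suffices
  to split the event according to \<open>X s \<le> c\<close>: on the first part the martingale property applies, on
  the second part \<open>min (X s) c\<close> is the largest possible value \<open>c\<close>.
\<close>

lemma truncated_martingale_integral_event:
  fixes X :: "real \<Rightarrow> 'a \<Rightarrow> real"
  assumes X: "martingale P F T X" and s: "s \<in> {0..T}" and B: "B \<in> sets (F s)"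
  shows "(\<integral>\<omega>. indicator B \<omega> * min (X T \<omega>) c \<partial>P) \<le> (\<integral>\<omega>. indicator B \<omega> * min (X s \<omega>) c \<partial>P)"
proof -
  define L where "L = B \<inter> {\<omega>\<in>space P. X s \<omega> \<le> c}"
  define U where "U = B - L"
  have [measurable]: "X s \<in> borel_measurable (F s)"
    using martingaleD(1)[OF X] s by (simp add: adapted_def)
  have "{\<omega>\<in>space (F s). X s \<omega> \<le> c} \<in> sets (F s)" by measurable
  then have LF: "L \<in> sets (F s)"
    using B by (auto simp: L_def)
  then have LU: "L \<in> sets P" "U \<in> sets P" "B \<in> sets P"
    using B s sets_F_subset by (auto simp: U_def)
  have T: "T \<in> {0..T}" using T_pos by simp
  note int = martingale_integrable_indicator[OF X s] martingale_integrable_indicator[OF X T]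
  have intU: "integrable P (\<lambda>\<omega>. indicator U \<omega> * c)"
    using integrable_mult_indicator[OF LU(2) integrable_const[of c]] by (simp only: real_scaleR_def)
  have Bsp: "\<omega> \<in> space P" if "\<omega> \<in> B" for \<omega>
    using LU sets.sets_into_space that by blast
  have "(\<integral>\<omega>. indicator B \<omega> * min (X T \<omega>) c \<partial>P)
      \<le> (\<integral>\<omega>. indicator L \<omega> * X T \<omega> + indicator U \<omega> * c \<partial>P)"
    using LU by (intro integral_mono int intU Bochner_Integration.integrable_add)
      (auto simp: U_def L_def indicator_def)
  also have "\<dots> = (\<integral>\<omega>. indicator L \<omega> * X s \<omega> \<partial>P) + (\<integral>\<omega>. indicator U \<omega> * c \<partial>P)"
    by (simp only: Bochner_Integration.integral_add[OF int(3)[OF LU(1)] intU]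
      martingale_integral_event[OF X s LF])
  also have "\<dots> = (\<integral>\<omega>. indicator L \<omega> * X s \<omega> + indicator U \<omega> * c \<partial>P)"
    by (rule Bochner_Integration.integral_add[OF int(1)[OF LU(1)] intU, symmetric])
  also have "\<dots> = (\<integral>\<omega>. indicator B \<omega> * min (X s \<omega>) c \<partial>P)"
    by (intro Bochner_Integration.integral_cong refl)
      (auto simp: U_def L_def indicator_def dest: Bsp)
  finally show ?thesis .
qed

text \<open>
  Optional sampling for a time with finitely many values reduces to the events \<open>B \<inter> {\<sigma> = s}\<close>, on each
  of which \<open>s\<close> is a deterministic time.
\<close>

lemma truncated_martingale_finite_sampling:
  fixes X :: "real \<Rightarrow> 'a \<Rightarrow> real"
  assumes X: "martingale P F T X" and S: "finite S" "S \<subseteq> {0..T}"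
    and \<sigma>: "\<And>\<omega>. \<omega> \<in> B \<Longrightarrow> \<sigma> \<omega> \<in> S"
    and event: "\<And>s. s \<in> S \<Longrightarrow> B \<inter> {\<omega>. \<sigma> \<omega> = s} \<in> sets (F s)"
  shows "integrable P (\<lambda>\<omega>. indicator B \<omega> * min (X (\<sigma> \<omega>) \<omega>) c)"
    and "(\<integral>\<omega>. indicator B \<omega> * min (X T \<omega>) c \<partial>P) \<le> (\<integral>\<omega>. indicator B \<omega> * min (X (\<sigma> \<omega>) \<omega>) c \<partial>P)"
proof -
  define C where "C s = B \<inter> {\<omega>. \<sigma> \<omega> = s}" for s
  have decompose: "indicator B \<omega> * f (\<sigma> \<omega>) = (\<Sum>s\<in>S. indicator (C s) \<omega> * f s)"
    for \<omega> and f :: "real \<Rightarrow> real"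
  proof (cases "\<omega> \<in> B")
    case True
    have "(\<Sum>s\<in>S. indicator (C s) \<omega> * f s) = (\<Sum>s\<in>S. if \<sigma> \<omega> = s then f s else 0)"
      by (rule sum.cong) (simp_all add: C_def True)
    also have "\<dots> = f (\<sigma> \<omega>)"
      using \<sigma>[OF True] by (simp only: sum.delta'[OF S(1)] if_True)
    finally show ?thesis using True by simp
  qed (simp add: C_def)
  have decompose_T: "indicator B \<omega> * min (X T \<omega>) c = (\<Sum>s\<in>S. indicator (C s) \<omega> * min (X T \<omega>) c)" for \<omega>
    using decompose[of \<omega> "\<lambda>_. min (X T \<omega>) c"] .
  have decompose_\<sigma>: "indicator B \<omega> * min (X (\<sigma> \<omega>) \<omega>) c
      = (\<Sum>s\<in>S. indicator (C s) \<omega> * min (X s \<omega>) c)" for \<omega>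
    using decompose[of \<omega> "\<lambda>s. min (X s \<omega>) c"] .
  have T: "T \<in> {0..T}" using T_pos by simp
  have s: "s \<in> {0..T}" "C s \<in> sets (F s)" "C s \<in> sets P" if "s \<in> S" for s
    using S(2) that event[OF that] sets_F_subset[of s "C s"] by (auto simp: C_def)
  note int = martingale_integrable_indicator(2)[OF X]
  show "integrable P (\<lambda>\<omega>. indicator B \<omega> * min (X (\<sigma> \<omega>) \<omega>) c)"
    unfolding decompose_\<sigma> by (intro Bochner_Integration.integrable_sum int s)
  have "(\<integral>\<omega>. indicator B \<omega> * min (X T \<omega>) c \<partial>P)
      = (\<Sum>s\<in>S. \<integral>\<omega>. indicator (C s) \<omega> * min (X T \<omega>) c \<partial>P)"
    unfolding decompose_T by (intro Bochner_Integration.integral_sum int s T)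
  also have "\<dots> \<le> (\<Sum>s\<in>S. \<integral>\<omega>. indicator (C s) \<omega> * min (X s \<omega>) c \<partial>P)"
    using truncated_martingale_integral_event[OF X s(1,2)] by (rule sum_mono)
  also have "\<dots> = (\<integral>\<omega>. indicator B \<omega> * min (X (\<sigma> \<omega>) \<omega>) c \<partial>P)"
    unfolding decompose_\<sigma> by (intro Bochner_Integration.integral_sum[symmetric] int s)
  finally show "(\<integral>\<omega>. indicator B \<omega> * min (X T \<omega>) c \<partial>P) \<le> (\<integral>\<omega>. indicator B \<omega> * min (X (\<sigma> \<omega>) \<omega>) c \<partial>P)" .
qed

end


section \<open>The first negative value along a finite set of times\<close>

text \<open>
  The terminal time \<open>T\<close> always qualifies, as the value for a path without negative values; it is meant
  to be the largest element of \<open>S\<close>.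
\<close>

definition first_negative :: "real \<Rightarrow> real set \<Rightarrow> (real \<Rightarrow> real) \<Rightarrow> real" where
  "first_negative T S d = Min {s\<in>S. s = T \<or> d s < 0}"

lemma first_negative_in:
  assumes "finite S" and "T \<in> S"
  shows "first_negative T S d \<in> S"
    and "first_negative T S d = T \<or> d (first_negative T S d) < 0"
proof -
  have "first_negative T S d \<in> {s\<in>S. s = T \<or> d s < 0}"
    unfolding first_negative_def using assms by (intro Min_in) auto
  then show "first_negative T S d \<in> S"
    "first_negative T S d = T \<or> d (first_negative T S d) < 0" by auto
qed

lemma first_negative_le:
  assumes "finite S" and "s \<in> S" and "d s < 0"
  shows "first_negative T S d \<le> s"
  unfolding first_negative_def using assms by (intro Min_le) auto

lemma first_negative_eq_iff:
  assumes "finite S" and "T \<in> S" and "S \<subseteq> {..T}" and "s \<in> S"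
  shows "first_negative T S d = s \<longleftrightarrow> (s = T \<or> d s < 0) \<and> (\<forall>u\<in>S. u < s \<longrightarrow> 0 \<le> d u)"
proof -
  have "{s\<in>S. s = T \<or> d s < 0} \<noteq> {}" using assms by auto
  then have "first_negative T S d = s \<longleftrightarrow>
      s \<in> {s\<in>S. s = T \<or> d s < 0} \<and> (\<forall>u\<in>{s\<in>S. s = T \<or> d s < 0}. s \<le> u)"
    unfolding first_negative_def using assms(1) by (subst Min_eq_iff) auto
  also have "\<dots> \<longleftrightarrow> (s = T \<or> d s < 0) \<and> (\<forall>u\<in>S. u < s \<longrightarrow> 0 \<le> d u)"
    using assms(3,4) by (fastforce simp: not_less[symmetric] subset_iff)
  finally show ?thesis .
qed

text \<open>
  If the path were negative at some time before the limit \<open>\<tau>\<close>, it would be so on an interval to the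
  right of that time, which meets the dense union of the \<open>S n\<close>; then some first negative time would lie
  before \<open>\<tau>\<close>, although they decrease to \<open>\<tau>\<close>. For the condition \<open>d s \<le> 0\<close> instead of \<open>d s < 0\<close> this
  would fail, since a path can vanish at an isolated time.
\<close>

lemma first_negative_limit:
  assumes S: "\<And>n. finite (S n)" "\<And>n. T \<in> S n" "\<And>n. S n \<subseteq> {t..T}" "incseq S"
    and dense: "\<And>a b. t \<le> a \<Longrightarrow> a < b \<Longrightarrow> b \<le> T \<Longrightarrow> \<exists>n. \<exists>s\<in>S n. a < s \<and> s < b"
    and right: "\<And>s. s \<in> {t..<T} \<Longrightarrow> (d \<longlongrightarrow> d s) (at_right s)"
  obtains \<tau> where "\<tau> \<in> {t..T}" "(\<lambda>n. first_negative T (S n) d) \<longlonglongrightarrow> \<tau>"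
    "\<And>s. s \<in> {t..<\<tau>} \<Longrightarrow> 0 \<le> d s"
proof -
  define \<sigma> where "\<sigma> n = first_negative T (S n) d" for n
  have \<sigma>: "\<sigma> n \<in> {t..T}" for n
    using first_negative_in(1)[OF S(1,2), of n d] S(3)[of n] by (auto simp: \<sigma>_def)
  have "decseq \<sigma>"
    unfolding decseq_def \<sigma>_def first_negative_def
  proof (intro allI impI Min_antimono)
    fix m n :: nat assume "m \<le> n"
    then show "{s\<in>S m. s = T \<or> d s < 0} \<subseteq> {s\<in>S n. s = T \<or> d s < 0}"
      using S(4) by (auto simp: incseq_def)
  qed (use S in auto)
  then obtain \<tau> where lim: "\<sigma> \<longlonglongrightarrow> \<tau>" and le: "\<And>n. \<tau> \<le> \<sigma> n"
    using \<sigma> by (metis atLeastAtMost_iff decseq_convergent)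
  have \<tau>: "\<tau> \<in> {t..T}"
    using LIMSEQ_le_const[OF lim] \<sigma> le[of 0] by (meson atLeastAtMost_iff order_trans)
  moreover have "0 \<le> d s" if s: "s \<in> {t..<\<tau>}" for s
  proof (rule ccontr)
    assume "\<not> 0 \<le> d s"
    then have "eventually (\<lambda>u. d u < 0) (at_right s)"
      using right[of s] s \<tau> by (intro order_tendstoD) auto
    then obtain b where b: "s < b" "\<And>u. s < u \<Longrightarrow> u < b \<Longrightarrow> d u < 0"
      by (auto simp: eventually_at_right_field)
    have "\<exists>n. \<exists>u\<in>S n. s < u \<and> u < min b \<tau>"
      using s b(1) \<tau> by (intro dense) auto
    then obtain n u where u: "u \<in> S n" "s < u" "u < min b \<tau>" by blast
    with b have "\<sigma> n \<le> u"
      unfolding \<sigma>_def by (intro first_negative_le S(1)) auto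
    with le[of n] u show False by simp
  qed
  ultimately show thesis
    using that lim unfolding \<sigma>_def by blast
qed


section \<open>A maximum principle\<close>

context stochastic_basis
begin

text \<open>
  First negative times along a finite set are stopping times: whether the first one is \<open>s\<close> is decided by
  the values of \<open>D\<close> up to time \<open>s\<close>.
\<close>

lemma first_negative_event:
  fixes D :: "real \<Rightarrow> 'a \<Rightarrow> real"
  assumes D: "adapted F T D" and S: "finite S" "T \<in> S" "S \<subseteq> {t..T}" and t: "0 \<le> t"
    and B: "B \<in> sets (F t)" and s: "s \<in> S"
  shows "B \<inter> {\<omega>. first_negative T S (\<lambda>u. D u \<omega>) = s} \<in> sets (F s)"
proof -
  have ts: "t \<le> s" using S s by auto
  have meas: "D u \<in> borel_measurable (F s)" if u: "u \<in> S" "u \<le> s" for u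
  proof (rule measurable_from_subalg)
    show "subalgebra (F s) (F u)"
      using sets_F_mono[OF u(2)] by (simp add: subalgebra_def)
    have "u \<in> {0..T}" using u(1) S(3) t by auto
    then show "D u \<in> borel_measurable (F u)"
      using D by (simp add: adapted_def)
  qed
  have "{\<omega>\<in>space (F s). s = T \<or> D s \<omega> < 0} \<in> sets (F s)"
  proof (cases "s = T")
    case False
    have [measurable]: "D s \<in> borel_measurable (F s)" using s by (intro meas) auto
    have "{\<omega>\<in>space (F s). D s \<omega> < 0} \<in> sets (F s)" by measurable
    then show ?thesis using False by simp
  next
    case True
    then show ?thesis using sets.top[of "F s"] by simp
  qed
  moreover have "{\<omega>\<in>space (F s). \<forall>u\<in>{u\<in>S. u < s}. 0 \<le> D u \<omega>} \<in> sets (F s)"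
  proof (rule sets.sets_Collect_finite_All)
    fix u assume "u \<in> {u\<in>S. u < s}"
    then have [measurable]: "D u \<in> borel_measurable (F s)" by (intro meas) auto
    show "{\<omega>\<in>space (F s). 0 \<le> D u \<omega>} \<in> sets (F s)" by measurable
  qed (use S(1) in simp)
  moreover have BF: "B \<in> sets (F s)"
    using B sets_F_mono[OF ts] by blast
  moreover have "B \<inter> {\<omega>. first_negative T S (\<lambda>u. D u \<omega>) = s}
      = B \<inter> {\<omega>\<in>space (F s). s = T \<or> D s \<omega> < 0}
          \<inter> {\<omega>\<in>space (F s). \<forall>u\<in>{u\<in>S. u < s}. 0 \<le> D u \<omega>}"
  proof -
    have "S \<subseteq> {..T}" using S(3) by auto
    note first_negative_eq_iff[OF S(1,2) this s]
    with sets.sets_into_space[OF BF] show ?thesis by auto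
  qed
  ultimately show ?thesis by (simp only: sets.Int)
qed

text \<open>
  A process that ends nonpositive, and whose drift \<open>V\<close> pushes it upwards as long as it is nonnegative,
  cannot be positive at an earlier time: it would have to be brought down by its martingale part \<open>K\<close>
  alone. The monotonicity of \<open>V\<close> is assumed on closed intervals of nonnegativity; continuity of \<open>V\<close>
  extends it to the limit \<open>\<tau>\<close>, where \<open>D\<close> may already have jumped below zero.
\<close>

lemma nonpositive_at_time:
  fixes D K V :: "real \<Rightarrow> 'a \<Rightarrow> real"
  assumes t: "t \<in> {0..T}"
    and K: "martingale P F T K"
    and D: "adapted F T D"
    and right: "AE \<omega> in P. \<forall>s\<in>{0..<T}. ((\<lambda>u. D u \<omega>) \<longlongrightarrow> D s \<omega>) (at_right s)"
    and terminal: "AE \<omega> in P. D T \<omega> \<le> 0"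
    and V_cont: "AE \<omega> in P. continuous_on {0..T} (\<lambda>s. V s \<omega>)"
    and V_mono: "AE \<omega> in P. \<forall>a b. 0 \<le> a \<longrightarrow> a \<le> b \<longrightarrow> b \<le> T \<longrightarrow>
      (\<forall>s\<in>{a..b}. 0 \<le> D s \<omega>) \<longrightarrow> V a \<omega> \<le> V b \<omega>"
    and decomp: "\<And>s. s \<in> {0..T} \<Longrightarrow>
      AE \<omega> in P. D s \<omega> = D T \<omega> - (K T \<omega> - K s \<omega>) - (V T \<omega> - V s \<omega>)"
  shows "AE \<omega> in P. D t \<omega> \<le> 0"
proof -
  define S where "S n = insert T (of_rat ` (from_nat :: nat \<Rightarrow> rat) ` {..n} \<inter> {t..T})" for n :: nat
  have S: "finite (S n)" "T \<in> S n" "S n \<subseteq> {t..T}" for n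
    using t by (auto simp: S_def)
  have "incseq S" by (auto simp: S_def incseq_def)
  have S0: "S n \<subseteq> {0..T}" for n using S(3)[of n] t by auto
  have dense: "\<exists>n. \<exists>s\<in>S n. a < s \<and> s < b" if ab: "t \<le> a" "a < b" "b \<le> T" for a b
  proof -
    obtain q :: rat where q: "a < of_rat q" "of_rat q < b"
      using of_rat_dense[OF ab(2)] by blast
    have "of_rat q \<in> S (to_nat q)"
      using q ab by (auto simp: S_def intro!: image_eqI[of _ _ "to_nat q"] image_eqI[of _ _ q])
    with q show ?thesis by blast
  qed
  define \<sigma> where "\<sigma> n \<omega> = first_negative T (S n) (\<lambda>s. D s \<omega>)" for n \<omega>
  have \<sigma>_in: "\<sigma> n \<omega> \<in> S n" for n \<omega>
    unfolding \<sigma>_def by (rule first_negative_in(1)[OF S(1,2)])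
  define B where "B = {\<omega>\<in>space P. 0 < D t \<omega>}"
  have Dt: "D t \<in> borel_measurable (F t)" using D t by (auto simp: adapted_def)
  then have "{\<omega>\<in>space (F t). 0 < D t \<omega>} \<in> sets (F t)" by measurable
  then have BF: "B \<in> sets (F t)" by (simp add: B_def)
  have [measurable]: "B \<in> sets P" using sets_F_subset[OF t BF] .
  have [measurable]: "D t \<in> borel_measurable P" using D t by (rule adapted_measurable)
  have T: "T \<in> {0..T}" using T_pos by simp
  \<comment> \<open>\<open>D t\<close> need not be integrable; cut off at \<open>1\<close>, it still detects the event \<open>B\<close>.\<close>
  define E where "E \<omega> = indicator B \<omega> * min (D t \<omega>) 1" for \<omega>
  have E_nonneg: "0 \<le> E \<omega>" for \<omega> by (auto simp: E_def B_def indicator_def)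
  have "E \<in> borel_measurable P" unfolding E_def by measurable
  moreover have "AE \<omega> in P. norm (E \<omega>) \<le> 1"
    by (auto simp: E_def B_def indicator_def)
  ultimately have E_int: "integrable P E" by (intro integrable_const_bound)
  have Kt_int: "integrable P (\<lambda>\<omega>. indicator B \<omega> * K t \<omega>)"
    using K t by (intro martingale_integrable_indicator) auto
  define W where "W \<omega> = indicator B \<omega> * K t \<omega> - E \<omega>" for \<omega>
  have W_int: "integrable P W" unfolding W_def using E_int Kt_int by simp
  have event: "B \<inter> {\<omega>. \<sigma> n \<omega> = s} \<in> sets (F s)" if "s \<in> S n" for n s
    unfolding \<sigma>_def using t that by (intro first_negative_event[OF D S _ BF]) auto
  \<comment> \<open>On \<open>B\<close>, \<open>W\<close> bounds the limit superior of \<open>K (\<sigma> n)\<close>. The maximum with \<open>W\<close> in the next steps supplies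
    the lower bound that dominated convergence needs, at no cost for the limit.\<close>
  define f where "f c n \<omega> = indicator B \<omega> * min (K (\<sigma> n \<omega>) \<omega>) c" for c n \<omega>
  have f_int: "integrable P (f c n)" for c n
    unfolding f_def by (rule truncated_martingale_finite_sampling(1)[OF K S(1) S0 \<sigma>_in event])
  have f_ge: "(\<integral>\<omega>. indicator B \<omega> * min (K T \<omega>) c \<partial>P) \<le> (\<integral>\<omega>. f c n \<omega> \<partial>P)" for c n
    unfolding f_def by (rule truncated_martingale_finite_sampling(2)[OF K S(1) S0 \<sigma>_in event])
  have "countable (insert t (\<Union>n. S n))" using S(1) by (auto intro: countable_finite)
  moreover have "AE \<omega> in P. D s \<omega> = D T \<omega> - (K T \<omega> - K s \<omega>) - (V T \<omega> - V s \<omega>)"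
    if "s \<in> insert t (\<Union>n. S n)" for s
  proof (rule decomp)
    show "s \<in> {0..T}" using S0 t that by blast
  qed
  ultimately have decomp_S: "AE \<omega> in P. \<forall>s\<in>insert t (\<Union>n. S n).
      D s \<omega> = D T \<omega> - (K T \<omega> - K s \<omega>) - (V T \<omega> - V s \<omega>)"
    by (simp only: AE_ball_countable) blast
  have limit: "AE \<omega> in P. (\<lambda>n. max (f c n \<omega>) (W \<omega>)) \<longlonglongrightarrow> W \<omega>" for c
    using right terminal V_cont V_mono decomp_S
  proof eventually_elim
    case (elim \<omega>)
    obtain \<tau> where \<tau>: "\<tau> \<in> {t..T}" "(\<lambda>n. \<sigma> n \<omega>) \<longlonglongrightarrow> \<tau>" "\<And>s. s \<in> {t..<\<tau>} \<Longrightarrow> 0 \<le> D s \<omega>"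
    proof (rule first_negative_limit[OF S \<open>incseq S\<close> dense, where d = "\<lambda>s. D s \<omega>"])
      show "((\<lambda>s. D s \<omega>) \<longlongrightarrow> D s \<omega>) (at_right s)" if "s \<in> {t..<T}" for s
        using elim(1) that t by auto
    qed (auto simp: \<sigma>_def)
    have V\<sigma>: "(\<lambda>n. V (\<sigma> n \<omega>) \<omega>) \<longlonglongrightarrow> V \<tau> \<omega>"
    proof (rule continuous_on_tendsto_compose[OF elim(3) \<tau>(2)])
      show "\<tau> \<in> {0..T}" using \<tau>(1) t by auto
      have "\<sigma> n \<omega> \<in> {0..T}" for n using S0 \<sigma>_in by blast
      then show "eventually (\<lambda>n. \<sigma> n \<omega> \<in> {0..T}) sequentially" by (intro always_eventually allI)
    qed
    \<comment> \<open>\<open>D\<close> is nonnegative on \<open>[t, s]\<close> for every \<open>s < \<tau>\<close>; let \<open>s\<close> increase to \<open>\<tau>\<close>.\<close>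
    note mono = elim(4)[rule_format]
    have V\<tau>: "V t \<omega> \<le> V \<tau> \<omega>"
    proof (cases "t = \<tau>")
      case False
      then have lt: "t < \<tau>" using \<tau> by auto
      have "((\<lambda>s. V s \<omega>) \<longlongrightarrow> V \<tau> \<omega>) (at \<tau> within {0..T})"
        using elim(3) \<tau>(1) t by (auto simp: continuous_on_def)
      then have "((\<lambda>s. V s \<omega>) \<longlongrightarrow> V \<tau> \<omega>) (at \<tau> within {t<..<\<tau>})"
        by (rule tendsto_within_subset) (use \<tau>(1) t in auto)
      moreover have "at \<tau> within {t<..<\<tau>} = at_left \<tau>"
        by (rule at_within_nhd[where S = "{t<..}"]) (use lt in auto)
      ultimately have "((\<lambda>s. V s \<omega>) \<longlongrightarrow> V \<tau> \<omega>) (at_left \<tau>)" by simp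
      moreover have "eventually (\<lambda>s. V t \<omega> \<le> V s \<omega>) (at_left \<tau>)"
        using eventually_at_left_real[OF lt]
      proof eventually_elim
        case (elim s)
        then show ?case
          using \<tau> t by (intro mono) auto
      qed
      ultimately show ?thesis
        by (rule tendsto_lowerbound) simp
    qed simp
    have upper: "max (f c n \<omega>) (W \<omega>) \<le> max (W \<omega> - (V (\<sigma> n \<omega>) \<omega> - V t \<omega>)) (W \<omega>)" for n
    proof (cases "\<omega> \<in> B")
      case True
      have "D (\<sigma> n \<omega>) \<omega> \<le> 0"
        using first_negative_in(2)[OF S(1,2), of n "\<lambda>s. D s \<omega>"] elim(2)
        unfolding \<sigma>_def by auto
      moreover have "D (\<sigma> n \<omega>) \<omega> = D T \<omega> - (K T \<omega> - K (\<sigma> n \<omega>) \<omega>) - (V T \<omega> - V (\<sigma> n \<omega>) \<omega>)"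
        using elim(5) \<sigma>_in by blast
      moreover have "D t \<omega> = D T \<omega> - (K T \<omega> - K t \<omega>) - (V T \<omega> - V t \<omega>)"
        using elim(5) by blast
      ultimately have "K (\<sigma> n \<omega>) \<omega> \<le> W \<omega> - (V (\<sigma> n \<omega>) \<omega> - V t \<omega>)"
        using True by (auto simp: W_def E_def)
      with True show ?thesis by (auto simp: f_def)
    qed (simp add: f_def W_def E_def)
    have "(\<lambda>n. max (W \<omega> - (V (\<sigma> n \<omega>) \<omega> - V t \<omega>)) (W \<omega>))
        \<longlonglongrightarrow> max (W \<omega> - (V \<tau> \<omega> - V t \<omega>)) (W \<omega>)"
      by (intro tendsto_intros V\<sigma>)
    then have lim: "(\<lambda>n. max (W \<omega> - (V (\<sigma> n \<omega>) \<omega> - V t \<omega>)) (W \<omega>)) \<longlonglongrightarrow> W \<omega>"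
      using V\<tau> by (simp add: max_def split: if_splits)
    show ?case
    proof (rule tendsto_sandwich[OF _ _ tendsto_const lim])
      show "eventually (\<lambda>n. max (f c n \<omega>) (W \<omega>)
          \<le> max (W \<omega> - (V (\<sigma> n \<omega>) \<omega> - V t \<omega>)) (W \<omega>)) sequentially"
        by (intro always_eventually allI upper)
    qed simp
  qed
  have truncated: "(\<integral>\<omega>. indicator B \<omega> * min (K T \<omega>) c \<partial>P) \<le> (\<integral>\<omega>. W \<omega> \<partial>P)" for c
  proof (rule LIMSEQ_le_const)
    show "(\<lambda>n. \<integral>\<omega>. max (f c n \<omega>) (W \<omega>) \<partial>P) \<longlonglongrightarrow> (\<integral>\<omega>. W \<omega> \<partial>P)"
    proof (rule integral_dominated_convergence[where w = "\<lambda>\<omega>. \<bar>c\<bar> + \<bar>W \<omega>\<bar>"])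
      show "AE \<omega> in P. norm (max (f c n \<omega>) (W \<omega>)) \<le> \<bar>c\<bar> + \<bar>W \<omega>\<bar>" for n
        by (rule AE_I2) (auto simp: f_def indicator_def max_def min_def)
    qed (use W_int f_int limit in auto)
    show "\<exists>N. \<forall>n\<ge>N. (\<integral>\<omega>. indicator B \<omega> * min (K T \<omega>) c \<partial>P) \<le> (\<integral>\<omega>. max (f c n \<omega>) (W \<omega>) \<partial>P)"
    proof (intro exI allI impI)
      show "(\<integral>\<omega>. indicator B \<omega> * min (K T \<omega>) c \<partial>P) \<le> (\<integral>\<omega>. max (f c n \<omega>) (W \<omega>) \<partial>P)" for n
        using f_int W_int by (intro order_trans[OF f_ge[of c n]] integral_mono) auto
    qed
  qed
  have KT: "integrable P (K T)" using K T by (rule martingaleD)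
  have "(\<lambda>m. \<integral>\<omega>. indicator B \<omega> * min (K T \<omega>) (real m) \<partial>P)
      \<longlonglongrightarrow> (\<integral>\<omega>. indicator B \<omega> * K T \<omega> \<partial>P)"
  proof (rule integral_dominated_convergence[where w = "\<lambda>\<omega>. \<bar>K T \<omega>\<bar>"])
    show "AE \<omega> in P. (\<lambda>m. indicator B \<omega> * min (K T \<omega>) (real m)) \<longlonglongrightarrow> indicator B \<omega> * K T \<omega>"
    proof (rule AE_I2, rule tendsto_eventually)
      fix \<omega>
      obtain m :: nat where "K T \<omega> \<le> real m" using real_arch_simple by blast
      then show "eventually (\<lambda>m. indicator B \<omega> * min (K T \<omega>) (real m) = indicator B \<omega> * K T \<omega>) sequentially"
        by (intro eventually_sequentiallyI[of m]) auto
    qed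
    show "AE \<omega> in P. norm (indicator B \<omega> * min (K T \<omega>) (real m)) \<le> \<bar>K T \<omega>\<bar>" for m
      by (rule AE_I2) (auto simp: indicator_def min_def)
  qed (use KT in auto)
  then have "(\<integral>\<omega>. indicator B \<omega> * K T \<omega> \<partial>P) \<le> (\<integral>\<omega>. W \<omega> \<partial>P)"
    by (rule LIMSEQ_le_const2) (use truncated in auto)
  also have "(\<integral>\<omega>. W \<omega> \<partial>P) = (\<integral>\<omega>. indicator B \<omega> * K t \<omega> \<partial>P) - (\<integral>\<omega>. E \<omega> \<partial>P)"
    unfolding W_def using E_int Kt_int by simp
  also have "(\<integral>\<omega>. indicator B \<omega> * K t \<omega> \<partial>P) = (\<integral>\<omega>. indicator B \<omega> * K T \<omega> \<partial>P)"
    by (rule martingale_integral_event[OF K t BF])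
  finally have "(\<integral>\<omega>. E \<omega> \<partial>P) = 0"
    using Bochner_Integration.integral_nonneg[of P E] E_nonneg by (intro antisym) auto
  then have "AE \<omega> in P. E \<omega> = 0"
    using integral_nonneg_eq_0_iff_AE[OF E_int] E_nonneg by auto
  then show ?thesis
    using AE_space by eventually_elim (auto simp: E_def B_def indicator_def min_def split: if_splits)
qed

lemma nonpositive_at_all_times:
  fixes D :: "real \<Rightarrow> 'a \<Rightarrow> real"
  assumes right: "AE \<omega> in P. \<forall>s\<in>{0..<T}. ((\<lambda>u. D u \<omega>) \<longlongrightarrow> D s \<omega>) (at_right s)"
    and each: "\<And>t. t \<in> {0..T} \<Longrightarrow> AE \<omega> in P. D t \<omega> \<le> 0"
  shows "AE \<omega> in P. \<forall>t\<in>{0..T}. D t \<omega> \<le> 0"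
proof -
  have "AE \<omega> in P. \<forall>s\<in>insert T (\<rat> \<inter> {0..T}). D s \<omega> \<le> 0"
    using T_pos each by (subst AE_ball_countable) (auto intro: countable_rat countable_subset)
  with right show ?thesis
  proof eventually_elim
    case (elim \<omega>)
    show ?case
    proof
      fix t assume t: "t \<in> {0..T}"
      show "D t \<omega> \<le> 0"
      proof (cases "t = T")
        case False
        show ?thesis
        proof (rule ccontr)
          assume "\<not> D t \<omega> \<le> 0"
          then have "eventually (\<lambda>u. 0 < D u \<omega>) (at_right t)"
            using elim(1) t False by (intro order_tendstoD[of _ "D t \<omega>"]) auto
          then obtain b where b: "t < b" "\<And>u. t < u \<Longrightarrow> u < b \<Longrightarrow> 0 < D u \<omega>"
            by (auto simp: eventually_at_right_field)
          obtain r where "r \<in> \<rat>" "t < r" "r < min b T"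
            using Rats_dense_in_real[of t "min b T"] b(1) t False by auto
          then have "0 < D r \<omega>" "D r \<omega> \<le> 0"
            using b(2)[of r] elim(2) t by auto
          then show False by simp
        qed
      qed (use elim in auto)
    qed
  qed
qed

end


section \<open>The comparison theorem\<close>

text \<open>
  A pathwise integral over \<open>]t,T]\<close>, as in the equations, is an increment of the primitive over \<open>]0,t]\<close>,
  for which continuity in time is known.
\<close>

lemma set_integral_split_interval:
  fixes f :: "real \<Rightarrow> real"
  assumes f: "set_integrable m {0<..T} f" and m: "sets m = sets borel"
    and ab: "0 \<le> a" "a \<le> b" "b \<le> T"
  shows "(LINT s:{0<..b}|m. f s) = (LINT s:{0<..a}|m. f s) + (LINT s:{a<..b}|m. f s)"
proof -
  have "{0<..b} = {0<..a} \<union> {a<..b}" using ab by auto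
  moreover have "set_integrable m {0<..a} f" "set_integrable m {a<..b} f"
    using ab by (auto intro!: set_integrable_subset[OF f] simp: m)
  ultimately show ?thesis by (simp add: set_integral_Un Int_def)
qed

theorem proposition3p1:
  fixes P :: "'a measure" and F :: "real \<Rightarrow> 'a measure" and T :: real
    and M :: "real \<Rightarrow> 'a \<Rightarrow> real ^ 'd" and A :: "real \<Rightarrow> 'a \<Rightarrow> real"
    and g h :: "'a \<Rightarrow> real \<Rightarrow> real \<Rightarrow> real" and \<xi> \<xi>' :: "'a \<Rightarrow> real"
    and Y Y' :: "real \<Rightarrow> 'a \<Rightarrow> real" and Z Z' :: "real \<Rightarrow> 'a \<Rightarrow> real ^ 'd"
  assumes "stochastic_basis P F T"
    and "square_integrable_martingale P F T M"
    and "predictable_representation P F T M"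
    and "bsde_clock P F T A"
    and "generator F T g" and "generator F T h"
    and "\<xi> \<in> borel_measurable (F T)" and "integrable P (\<lambda>\<omega>. (\<xi> \<omega>)\<^sup>2)"
    and "\<xi>' \<in> borel_measurable (F T)" and "integrable P (\<lambda>\<omega>. (\<xi>' \<omega>)\<^sup>2)"
    and "gbsde_solution P F T M A g \<xi> Y Z"
    and "gbsde_solution P F T M A h \<xi>' Y' Z'"
    and "AE \<omega> in P. \<xi> \<omega> \<ge> \<xi>' \<omega>"
    and "\<And>\<omega> t y. \<omega> \<in> space P \<Longrightarrow> t \<in> {0..T} \<Longrightarrow> g \<omega> t y \<ge> h \<omega> t y"
    and "\<And>\<omega> t. \<omega> \<in> space P \<Longrightarrow> t \<in> {0..T} \<Longrightarrow> antimono (g \<omega> t)"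
  shows "\<P>(\<omega> in P. \<forall>t\<in>{0..T}. Y t \<omega> \<ge> Y' t \<omega>) = 1"
proof -
  interpret stochastic_basis P F T by fact
  note sol = assms(11)[unfolded gbsde_solution_def Let_def]
    and sol' = assms(12)[unfolded gbsde_solution_def Let_def]
  define m where "m \<omega> = stieltjes T A \<omega>" for \<omega>
  have sets_m: "sets (m \<omega>) = sets borel" for \<omega>
    by (simp add: m_def stieltjes_def)
  define G where "G t \<omega> = (LINT s:{0<..t}|m \<omega>. g \<omega> s (Y s \<omega>))" for t \<omega>
  define H where "H t \<omega> = (LINT s:{0<..t}|m \<omega>. h \<omega> s (Y' s \<omega>))" for t \<omega>
  obtain N where N: "martingale P F T N" "\<And>t. t \<in> {0..T} \<Longrightarrow> AE \<omega> in P.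
      Y t \<omega> = \<xi> \<omega> - (N T \<omega> - N t \<omega>) + (LINT s:{t<..T}|m \<omega>. g \<omega> s (Y s \<omega>))"
    using sol unfolding m_def by blast
  obtain N' where N': "martingale P F T N'" "\<And>t. t \<in> {0..T} \<Longrightarrow> AE \<omega> in P.
      Y' t \<omega> = \<xi>' \<omega> - (N' T \<omega> - N' t \<omega>) + (LINT s:{t<..T}|m \<omega>. h \<omega> s (Y' s \<omega>))"
    using sol' unfolding m_def by blast
  have int: "AE \<omega> in P. set_integrable (m \<omega>) {0<..T} (\<lambda>s. g \<omega> s (Y s \<omega>))"
    and int': "AE \<omega> in P. set_integrable (m \<omega>) {0<..T} (\<lambda>s. h \<omega> s (Y' s \<omega>))"
    using sol sol' unfolding m_def by blast+
  have "AE \<omega> in P. continuous_on {0..T} (\<lambda>t. G t \<omega>)" "AE \<omega> in P. continuous_on {0..T} (\<lambda>t. H t \<omega>)"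
    using sol sol' unfolding m_def G_def H_def by auto
  then have cont: "AE \<omega> in P. continuous_on {0..T} (\<lambda>t. G t \<omega> - H t \<omega>)"
    by eventually_elim (rule continuous_on_diff)
  have "AE \<omega> in P. cadlag_on T (\<lambda>t. Y t \<omega>)" "AE \<omega> in P. cadlag_on T (\<lambda>t. Y' t \<omega>)"
    using sol sol' unfolding cadlag_process_def by auto
  then have right: "AE \<omega> in P. \<forall>s\<in>{0..<T}.
      ((\<lambda>u. Y' u \<omega> - Y u \<omega>) \<longlongrightarrow> Y' s \<omega> - Y s \<omega>) (at_right s)"
    by eventually_elim (auto simp: cadlag_on_def intro!: tendsto_diff)
  have T: "T \<in> {0..T}" using T_pos by simp
  have terminal: "AE \<omega> in P. Y T \<omega> = \<xi> \<omega> \<and> Y' T \<omega> = \<xi>' \<omega>"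
    using N(2)[OF T] N'(2)[OF T] by eventually_elim (simp add: set_lebesgue_integral_def)
  have drift: "AE \<omega> in P. \<forall>a b. 0 \<le> a \<longrightarrow> a \<le> b \<longrightarrow> b \<le> T \<longrightarrow>
      (\<forall>s\<in>{a..b}. 0 \<le> Y' s \<omega> - Y s \<omega>) \<longrightarrow> G a \<omega> - H a \<omega> \<le> G b \<omega> - H b \<omega>"
    using int int' AE_space
  proof eventually_elim
    case (elim \<omega>)
    show ?case
    proof (intro allI impI)
      fix a b assume ab: "0 \<le> a" "a \<le> b" "b \<le> T" and D: "\<forall>s\<in>{a..b}. 0 \<le> Y' s \<omega> - Y s \<omega>"
      have "(LINT s:{a<..b}|m \<omega>. h \<omega> s (Y' s \<omega>)) \<le> (LINT s:{a<..b}|m \<omega>. g \<omega> s (Y s \<omega>))"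
      proof (rule set_integral_mono)
        show "set_integrable (m \<omega>) {a<..b} (\<lambda>s. h \<omega> s (Y' s \<omega>))"
          "set_integrable (m \<omega>) {a<..b} (\<lambda>s. g \<omega> s (Y s \<omega>))"
          using ab elim by (auto intro: set_integrable_subset simp: sets_m)
        fix s assume s: "s \<in> {a<..b}"
        have "h \<omega> s (Y' s \<omega>) \<le> g \<omega> s (Y' s \<omega>)"
          using s ab elim by (intro assms(14)) auto
        also have "\<dots> \<le> g \<omega> s (Y s \<omega>)"
          using s ab elim D by (intro antimonoD[OF assms(15)]) auto
        finally show "h \<omega> s (Y' s \<omega>) \<le> g \<omega> s (Y s \<omega>)" .
      qed
      then show "G a \<omega> - H a \<omega> \<le> G b \<omega> - H b \<omega>"
        unfolding G_def H_def
        using set_integral_split_interval[OF elim(1) sets_m ab]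
          set_integral_split_interval[OF elim(2) sets_m ab] by simp
    qed
  qed
  have "AE \<omega> in P. Y' t \<omega> - Y t \<omega> \<le> 0" if t: "t \<in> {0..T}" for t
  proof (rule nonpositive_at_time[where D = "\<lambda>t \<omega>. Y' t \<omega> - Y t \<omega>", OF t
        martingale_diff[OF N'(1) N(1)] _ right _ cont drift])
    show "adapted F T (\<lambda>t \<omega>. Y' t \<omega> - Y t \<omega>)"
      using sol sol' by (intro adapted_diff) auto
    show "AE \<omega> in P. Y' T \<omega> - Y T \<omega> \<le> 0"
      using terminal assms(13) by eventually_elim simp
    show "AE \<omega> in P. Y' s \<omega> - Y s \<omega> = Y' T \<omega> - Y T \<omega> - (N' T \<omega> - N T \<omega> - (N' s \<omega> - N s \<omega>))
        - (G T \<omega> - H T \<omega> - (G s \<omega> - H s \<omega>))" if s: "s \<in> {0..T}" for s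
      using N(2)[OF s] N'(2)[OF s] terminal int int'
    proof eventually_elim
      case (elim \<omega>)
      then show ?case
        unfolding G_def H_def
        using s set_integral_split_interval[OF elim(4) sets_m, of s T]
          set_integral_split_interval[OF elim(5) sets_m, of s T] by simp
    qed
  qed
  from nonpositive_at_all_times[OF right this]
  have ae: "AE \<omega> in P. \<forall>t\<in>{0..T}. Y t \<omega> \<ge> Y' t \<omega>" by simp
  \<comment> \<open>The event is an uncountable intersection; it is measurable because \<open>P\<close> is complete.\<close>
  then have "{\<omega>\<in>space P. \<forall>t\<in>{0..T}. Y t \<omega> \<ge> Y' t \<omega>} \<in> sets P"
    by (intro in_sets_AE[OF _ sets.top]) auto
  with ae show ?thesis
    by (simp add: prob_Collect_eq_1)
qed

end
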